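(* For every integer $t \ge 3$ and every $\nu \in [0,1]$, \[ \Phi_t(\nu) = \begin{cases} \frac{t-1}{t}\,\Phi_t(t\nu) & \text{if } \nu < 1/t,\\[2pt] \frac{t-1}{t} + \frac{1}{t}\,\Phi_t\!\left(\frac{t\nu - 1}{t-1}\right) & \text{if } \nu \ge 1/t. \end{cases} \]
   Context: $K_t^n$ is the graph with vertex set $[t]^n = \{1,\dots,t\}^n$ in which $x,y$ are adjacent iff $x_i \neq y_i$ for all $i \in [n]$. For $S \subseteq [t]^n$, $\mu(S) := |S|/t^n$ and $\partial S := \{x \in [t]^n : \exists y \in S \text{ adjacent to } x\}$ (the vertex boundary, possibly containing points of $S$). For $\nu\in[0,1]$, $\Phi(K_t^n,\nu) := \inf\{\mu(\partial S) : S \subseteq [t]^n,\ \mu(S) \ge \nu\}$ and $\Phi_t(\nu) := \inf_{n \ge 1} \Phi(K_t^n, \nu)$. *)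

theory Defs
  imports Complex_Main "HOL-Library.FuncSet"
begin

(* Points of [t]^n are extensional functions {1..n} -> {1..t}, so that equality of
   functions is equality of tuples and n can range inside a formula. *)
definition Kverts :: "nat \<Rightarrow> nat \<Rightarrow> (nat \<Rightarrow> nat) set" where
  "Kverts t n = {1..n} \<rightarrow>\<^sub>E {1..t}"

definition Kadj :: "nat \<Rightarrow> nat \<Rightarrow> (nat \<Rightarrow> nat) \<Rightarrow> (nat \<Rightarrow> nat) \<Rightarrow> bool" where
  "Kadj t n x y \<longleftrightarrow>
     x \<in> Kverts t n \<and> y \<in> Kverts t n \<and> (\<forall>i\<in>{1..n}. x i \<noteq> y i)"

definition Kmu :: "nat \<Rightarrow> nat \<Rightarrow> (nat \<Rightarrow> nat) set \<Rightarrow> real" where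
  "Kmu t n S = real (card S) / real t ^ n"

(* May contain points of S itself. *)
definition Kboundary :: "nat \<Rightarrow> nat \<Rightarrow> (nat \<Rightarrow> nat) set \<Rightarrow> (nat \<Rightarrow> nat) set" where
  "Kboundary t n S = {x \<in> Kverts t n. \<exists>y\<in>S. Kadj t n x y}"

(* For nu \<le> 1 and t \<ge> 1 the infima below are over nonempty sets of reals bounded below by 0,
   so the real-valued Inf is the genuine infimum. *)
definition Phi_graph :: "nat \<Rightarrow> nat \<Rightarrow> real \<Rightarrow> real" where
  "Phi_graph t n \<nu> =
     Inf {Kmu t n (Kboundary t n S) | S. S \<subseteq> Kverts t n \<and> Kmu t n S \<ge> \<nu>}"

definition Phi :: "nat \<Rightarrow> real \<Rightarrow> real" where
  "Phi t \<nu> = (INF n\<in>{1..}. Phi_graph t n \<nu>)"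

end

theory Submission
  imports Defs
begin

text \<open>
  Write \<open>p = 1/t\<close>, \<open>q = 1 - p\<close> and let \<open>T\<close> be the operator on functions on \<open>[0,1]\<close> given by the
  right-hand side of the recursion. Placing \<open>S\<close> in one slice of the next power, or
  one full slice and copies of \<open>S\<close> in the others, gives \<open>\<Phi> \<le> T \<Phi>\<close>.

  Conversely, slice \<open>S\<close> along one coordinate and let \<open>U\<close> and \<open>V\<close> be the sets of points lying in at
  least one, respectively at least two, slices. Counting fibres gives
  \<open>\<mu>(S) \<le> p \<mu>(U) + q \<mu>(V)\<close> and \<open>\<mu>(\<partial>S) \<ge> q \<mu>(\<partial>U) + p \<mu>(\<partial>V)\<close>, so by induction on the dimension
  \<open>\<mu>(\<partial>S) \<ge> f(\<mu>(S))\<close> for every monotone \<open>f\<close> fixing 0 and 1 with the two-point inequality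
  \<open>f(p u + q v) \<le> q f(u) + p f(v)\<close> for \<open>v \<le> u\<close>. The identity is such an \<open>f\<close>, and \<open>T\<close> preserves the
  two-point inequality jointly with \<open>f \<le> T f\<close>, subadditivity, and the dual inequality
  \<open>1 + f(a + b - 1) \<le> f(a) + f(b)\<close> for \<open>a + b \<ge> 1\<close>. Hence \<open>T\<^sup>k id \<le> \<Phi>\<close> for all \<open>k\<close>. As \<open>T\<close> contracts with
  factor \<open>q\<close>, also \<open>T \<Phi> \<le> T\<^sup>k id + q\<^sup>k\<close>, and \<open>k \<rightarrow> \<infinity>\<close> yields \<open>T \<Phi> \<le> \<Phi>\<close>.
\<close>

section \<open>The recursion as an operator on profiles\<close>

text \<open>The operator \<open>T\<close> of the overview with its breakpoint at a real
  \<open>p\<close>; for \<open>p = 1/t\<close>, clearing denominators gives the recursion.\<close>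

definition iso_step :: "real \<Rightarrow> (real \<Rightarrow> real) \<Rightarrow> real \<Rightarrow> real" where
  "iso_step p f x = (if x < p then (1 - p) * f (x / p) else (1 - p) + p * f ((x - p) / (1 - p)))"

text \<open>A bundle of clauses stable under \<open>iso_step\<close>. The values at 0 and 1,
  monotonicity and the two-point inequality drive the induction on the dimension; the other three
  carry the two-point inequality across the breakpoint. The clause with \<open>a + b - 1\<close>
  says that \<open>1 - f (1 - x)\<close> is superadditive.\<close>

definition profile :: "real \<Rightarrow> (real \<Rightarrow> real) \<Rightarrow> bool" where
  "profile p f \<longleftrightarrow> f 0 = 0 \<and> f 1 = 1 \<and>
     (\<forall>x y. 0 \<le> x \<longrightarrow> x \<le> y \<longrightarrow> y \<le> 1 \<longrightarrow> f x \<le> f y) \<and>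
     (\<forall>a b. 0 \<le> a \<longrightarrow> 0 \<le> b \<longrightarrow> a + b \<le> 1 \<longrightarrow> f (a + b) \<le> f a + f b) \<and>
     (\<forall>a b. a \<le> 1 \<longrightarrow> b \<le> 1 \<longrightarrow> 1 \<le> a + b \<longrightarrow> 1 + f (a + b - 1) \<le> f a + f b) \<and>
     (\<forall>x. 0 \<le> x \<longrightarrow> x \<le> 1 \<longrightarrow> f x \<le> iso_step p f x) \<and>
     (\<forall>u v. 0 \<le> v \<longrightarrow> v \<le> u \<longrightarrow> u \<le> 1 \<longrightarrow>
        f (p * u + (1 - p) * v) \<le> (1 - p) * f u + p * f v)"

lemma profileD:
  assumes "profile p f"
  shows profile_0: "f 0 = 0"
    and profile_1: "f 1 = 1"
    and profile_mono: "\<And>x y. 0 \<le> x \<Longrightarrow> x \<le> y \<Longrightarrow> y \<le> 1 \<Longrightarrow> f x \<le> f y"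
    and profile_subadd: "\<And>a b. 0 \<le> a \<Longrightarrow> 0 \<le> b \<Longrightarrow> a + b \<le> 1 \<Longrightarrow> f (a + b) \<le> f a + f b"
    and profile_cosubadd: "\<And>a b. a \<le> 1 \<Longrightarrow> b \<le> 1 \<Longrightarrow> 1 \<le> a + b \<Longrightarrow> 1 + f (a + b - 1) \<le> f a + f b"
    and profile_le_step: "\<And>x. 0 \<le> x \<Longrightarrow> x \<le> 1 \<Longrightarrow> f x \<le> iso_step p f x"
    and profile_two_point: "\<And>u v. 0 \<le> v \<Longrightarrow> v \<le> u \<Longrightarrow> u \<le> 1 \<Longrightarrow>
        f (p * u + (1 - p) * v) \<le> (1 - p) * f u + p * f v"
  using assms unfolding profile_def by auto

lemma iso_step_mono:
  assumes p: "0 < p" "p < 1" and x: "0 \<le> x" "x \<le> 1"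
    and le: "\<And>y. 0 \<le> y \<Longrightarrow> y \<le> 1 \<Longrightarrow> f y \<le> g y"
  shows "iso_step p f x \<le> iso_step p g x"
proof (cases "x < p")
  case True
  then have "f (x / p) \<le> g (x / p)" using p x by (intro le) auto
  then show ?thesis using True p by (simp add: iso_step_def)
next
  case False
  then have "f ((x - p) / (1 - p)) \<le> g ((x - p) / (1 - p))" using p x by (intro le) auto
  then show ?thesis using False p by (simp add: iso_step_def)
qed

text \<open>The constant is scaled by \<open>1 - p\<close> below the breakpoint and by
  \<open>p\<close> from there on; \<open>p \<le> 1 / 2\<close> makes the former the larger. This
  gives the contraction factor.\<close>

lemma iso_step_add_const:
  assumes "0 < p" "p \<le> 1 / 2" "0 \<le> c"
  shows "iso_step p (\<lambda>y. f y + c) x \<le> iso_step p f x + (1 - p) * c"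
proof -
  have "p * c \<le> (1 - p) * c" using assms by (intro mult_right_mono) auto
  then show ?thesis by (simp add: iso_step_def algebra_simps)
qed

text \<open>Passes to the coordinate \<open>a\<close> of \<open>x\<close> inside its branch, in
  which \<open>iso_step\<close> is an affine function of \<open>f a\<close>.\<close>

lemma unit_interval_cases [consumes 4]:
  fixes p x :: real
  assumes "0 < p" "p < 1" "0 \<le> x" "x \<le> 1"
  obtains (low) a where "0 \<le> a" "a < 1" "x = p * a"
  | (high) a where "0 \<le> a" "a \<le> 1" "x = p + (1 - p) * a"
proof (cases "x < p")
  case True
  then show ?thesis using low[of "x / p"] assms by auto
next
  case False
  then show ?thesis using high[of "(x - p) / (1 - p)"] assms by auto
qed

section \<open>Invariance of profiles under the operator\<close>

context
  fixes p q :: real and f :: "real \<Rightarrow> real"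
  assumes p_pos: "0 < p" and p_half: "p \<le> 1 / 2" and q_def: "q = 1 - p" and prof: "profile p f"
begin

private lemma pq: "0 < q" "p \<le> q" "q < 1" "p < 1" "p + q = 1"
  using p_pos p_half q_def by auto

private lemmas f0 = profile_0[OF prof]
private lemmas f1 = profile_1[OF prof]
private lemmas fmono = profile_mono[OF prof]
private lemmas fsub = profile_subadd[OF prof]
private lemmas fcosub = profile_cosubadd[OF prof]
private lemmas fstep = profile_le_step[OF prof]
private lemmas ftwo = profile_two_point[OF prof, folded q_def]

private lemma f_nonneg: "0 \<le> x \<Longrightarrow> x \<le> 1 \<Longrightarrow> 0 \<le> f x"
  using fmono[of 0 x] f0 by simp

private lemma f_le_1: "0 \<le> x \<Longrightarrow> x \<le> 1 \<Longrightarrow> f x \<le> 1"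
  using fmono[of x 1] f1 by simp

private lemma cases_unit [consumes 2]:
  assumes "0 \<le> x" "x \<le> 1"
  obtains (low) a where "0 \<le> a" "a < 1" "x = p * a"
  | (high) a where "0 \<le> a" "a \<le> 1" "x = p + q * a"
  using unit_interval_cases[of p x] assms p_pos pq unfolding q_def by metis

text \<open>The branches agree at the breakpoint: for \<open>a = 1\<close> the second one gives
  \<open>q + p * f 0 = q = q * f 1\<close>. Hence \<open>a = 1\<close> may be included.\<close>

private lemma step_low: "a \<le> 1 \<Longrightarrow> iso_step p f (p * a) = q * f a"
  using p_pos pq f0 f1 by (cases "a = 1") (auto simp: iso_step_def q_def)

private lemma step_high: "0 \<le> a \<Longrightarrow> iso_step p f (p + q * a) = q + p * f a"
proof -
  assume "0 \<le> a"
  then have "\<not> q * a < 0" using pq by (simp add: not_less)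
  then show ?thesis using pq by (simp add: iso_step_def flip: q_def)
qed

text \<open>The value \<open>q\<close> separates the branches, as
  \<open>q * f a \<le> q \<le> q + p * f b\<close>; inside a branch, monotonicity of
  \<open>f\<close> is rescaled.\<close>

private lemma step_mono:
  assumes "0 \<le> x" "x \<le> y" "y \<le> 1"
  shows "iso_step p f x \<le> iso_step p f y"
proof -
  have x1: "x \<le> 1" and y0: "0 \<le> y" using assms by auto
  from assms(1) x1 show ?thesis
  proof (cases rule: cases_unit)
    case (low a)
    note a = this
    from y0 assms(3) show ?thesis
    proof (cases rule: cases_unit)
      case (low b)
      then have "a \<le> b" using a assms p_pos by simp
      then show ?thesis using a low fmono[of a b] pq by (simp add: step_low)
    next
      case (high b)
      have "q * f a \<le> q * 1" using f_le_1[of a] a pq by (intro mult_left_mono) auto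
      moreover have "0 \<le> p * f b" using f_nonneg[of b] high p_pos by simp
      ultimately show ?thesis using a high by (simp add: step_low step_high)
    qed
  next
    case (high a)
    note a = this
    from y0 assms(3) show ?thesis
    proof (cases rule: cases_unit)
      case (low b)
      have "p * b < p" using low p_pos by simp
      moreover have "0 \<le> q * a" using a pq by simp
      ultimately show ?thesis using a low assms by simp
    next
      case (high b)
      then have "a \<le> b" using a assms pq by simp
      then show ?thesis using a high fmono[of a b] p_pos by (simp add: step_high)
    qed
  qed
qed

text \<open>Two low points use subadditivity of \<open>f\<close> if their sum stays low and the dual
  inequality if it passes \<open>p\<close>; a low and a high point use subadditivity again. Two high
  points contribute at least \<open>q\<close> each, and \<open>2 * q \<ge> 1\<close>.\<close>

private lemma step_subadd_ordered:
  assumes "0 \<le> a" "a \<le> b" "a + b \<le> 1"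
  shows "iso_step p f (a + b) \<le> iso_step p f a + iso_step p f b"
proof -
  have a1: "a \<le> 1" and b0: "0 \<le> b" and b1: "b \<le> 1" and ab0: "0 \<le> a + b" using assms by auto
  from assms(1) a1 show ?thesis
  proof (cases rule: cases_unit)
    case (low a')
    note a = this
    from b0 b1 show ?thesis
    proof (cases rule: cases_unit)
      case (low b')
      note b = this
      have sum: "a + b = p * (a' + b')" using a b by (simp add: algebra_simps)
      show ?thesis
      proof (cases "a' + b' \<le> 1")
        case True
        then have "q * f (a' + b') \<le> q * (f a' + f b')"
          using fsub[of a' b'] a b pq by (intro mult_left_mono) auto
        then show ?thesis unfolding sum using a b True by (simp add: step_low flip: distrib_left)
      next
        case False
        \<comment> \<open>The sum exceeds the breakpoint by \<open>p * s\<close>, which is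
          \<open>p / q * s \<le> s\<close> in the coordinate of the high branch.\<close>
        define s where "s = a' + b' - 1"
        have s: "0 \<le> s" "s \<le> 1" using False a b by (auto simp: s_def)
        have ps: "p / q * s \<le> s" using s pq p_pos
          by (intro mult_left_le_one_le) auto
        have ps0: "0 \<le> p / q * s" using s pq p_pos by simp
        have "q * (p / q * s) = p * s" using pq by simp
        then have "a + b = p + q * (p / q * s)" using sum by (simp add: s_def algebra_simps)
        then have "iso_step p f (a + b) = q + p * f (p / q * s)" using ps0 by (metis step_high)
        also have "\<dots> \<le> q + p * f s" using fmono[OF ps0 ps s(2)] p_pos by simp
        also have "\<dots> \<le> q + q * f s" using f_nonneg[OF s] pq by (simp add: mult_right_mono)
        also have "\<dots> = q * (1 + f s)" by (simp add: algebra_simps)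
        also have "\<dots> \<le> q * (f a' + f b')"
          using fcosub[of a' b'] False a b pq by (intro mult_left_mono) (auto simp: s_def)
        finally show ?thesis using a b by (simp add: step_low distrib_left[of q])
      qed
    next
      case (high b')
      note b = this
      \<comment> \<open>The increment \<open>a = p * a'\<close> measured in the coordinate of the
        high branch, where it shrinks because \<open>p \<le> q\<close>.\<close>
      define r where "r = p / q * a'"
      have "p / q * a' \<le> a'" using a pq p_pos by (intro mult_left_le_one_le) auto
      then have r: "0 \<le> r" "r \<le> a'" using a pq p_pos by (auto simp: r_def)
      have sum: "a + b = p + q * (r + b')" using a b pq by (simp add: r_def algebra_simps)
      have "q * (r + b') \<le> q * 1" using sum assms(3) pq(5) by linarith
      then have rb: "r + b' \<le> 1" using pq by (simp only: mult_le_cancel_left_pos)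
      have "f (r + b') \<le> f a' + f b'" using fsub[of r b'] fmono[of r a'] r rb a b by simp
      then have "p * f (r + b') \<le> p * f a' + p * f b'" using p_pos
        by (metis distrib_left mult_left_mono less_imp_le)
      also have "\<dots> \<le> q * f a' + p * f b'" using f_nonneg[of a'] a pq by (simp add: mult_right_mono)
      finally show ?thesis unfolding sum using a b r by (simp add: step_low step_high)
    qed
  next
    case (high a')
    note a = this
    have "iso_step p f p = q" using step_low[of 1] f1 by simp
    moreover have "p \<le> a" using a pq by simp
    ultimately have "q \<le> iso_step p f a" "q \<le> iso_step p f b"
      using step_mono[of p a] step_mono[of p b] a1 b1 assms(2) p_pos by auto
    moreover have "iso_step p f (a + b) \<le> iso_step p f 1" using step_mono ab0 assms(3) by simp
    moreover have "iso_step p f 1 = 1" using step_high[of 1] f1 pq by simp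
    ultimately show ?thesis using pq by linarith
  qed
qed

text \<open>The larger point is high, since two points below \<open>p \<le> 1 / 2\<close> cannot sum
  to 1. The dual inequality for \<open>f\<close> then applies, except when both points are high and
  \<open>a + b - 1\<close> drops below \<open>p\<close>; there subadditivity takes over.\<close>

private lemma step_cosubadd_ordered:
  assumes "a \<le> b" "b \<le> 1" "1 \<le> a + b"
  shows "1 + iso_step p f (a + b - 1) \<le> iso_step p f a + iso_step p f b"
proof -
  have a0: "0 \<le> a" and a1: "a \<le> 1" and b0: "0 \<le> b" using assms by auto
  from b0 assms(2) show ?thesis
  proof (cases rule: cases_unit)
    case (low b')
    then have "b < p" using p_pos by simp
    then show ?thesis using assms p_half by simp
  next
    case (high b')
    note b = this
    from a0 a1 show ?thesis
    proof (cases rule: cases_unit)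
      case (low a')
      note a = this
      \<comment> \<open>The deficit \<open>1 - b = q * (1 - b')\<close> measured in the coordinate
        of the low branch, where it grows by the factor \<open>q / p \<ge> 1\<close>.\<close>
      define r where "r = q / p * (1 - b')"
      have "1 * (1 - b') \<le> q / p * (1 - b')" using b pq p_pos by (intro mult_right_mono) auto
      then have r: "1 - b' \<le> r" by (simp add: r_def)
      have "p * r = q * (1 - b')" using p_pos by (simp add: r_def)
      then have sum: "a + b - 1 = p * (a' - r)" using a b pq(5) by (simp add: algebra_simps)
      then have "0 \<le> p * (a' - r)" using assms by simp
      then have ra: "r \<le> a'" using p_pos by (simp add: zero_le_mult_iff)
      have "f (a' - r) \<le> f (a' + b' - 1)" using r ra a b by (intro fmono) auto
      then have "1 + f (a' - r) \<le> f a' + f b'" using fcosub[of a' b'] a b r ra by simp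
      then have "q * (f (a' - r) - f a') \<le> q * (f b' - 1)" using pq by (intro mult_left_mono) auto
      \<comment> \<open>Since \<open>f b' - 1\<close> is nonpositive, the smaller factor gives the
        larger product.\<close>
      also have "\<dots> \<le> p * (f b' - 1)" using f_le_1[of b'] b pq by (intro mult_right_mono_neg) auto
      finally have "1 + q * f (a' - r) \<le> q * f a' + (q + p * f b')"
        using pq(5) by (simp add: algebra_simps)
      moreover have "a' - r \<le> 1" using a b r by simp
      ultimately show ?thesis unfolding sum using a b by (simp add: step_low step_high)
    next
      case (high a')
      note a = this
      have sum: "a + b - 1 = p + q * (a' + b' - 1)" using a b pq(5) by (simp add: algebra_simps)
      show ?thesis
      proof (cases "1 \<le> a' + b'")
        case True
        then have "p * (1 + f (a' + b' - 1)) \<le> p * (f a' + f b')"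
          using fcosub[of a' b'] a b p_pos by (intro mult_left_mono) auto
        then have "1 + (q + p * f (a' + b' - 1)) \<le> (q + p * f a') + (q + p * f b')"
          using pq(5) by (simp add: algebra_simps)
        then show ?thesis unfolding sum using a b True by (simp add: step_high)
      next
        case False
        \<comment> \<open>Here \<open>a + b - 1\<close> falls short of the breakpoint by
          \<open>q * (1 - s)\<close>, which is \<open>r\<close> in the coordinate of the low
          branch.\<close>
        define s where "s = a' + b'"
        define r where "r = q / p * (1 - s)"
        have s: "0 \<le> s" "s \<le> 1" using False a b by (auto simp: s_def)
        have "1 * (1 - s) \<le> q / p * (1 - s)" using s pq p_pos by (intro mult_right_mono) auto
        then have r: "1 - s \<le> r" by (simp add: r_def)
        have "p * r = q * (1 - s)" using p_pos by (simp add: r_def)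
        then have sum': "a + b - 1 = p * (1 - r)" unfolding sum by (simp add: s_def algebra_simps)
        then have "0 \<le> p * (1 - r)" using assms by simp
        then have r1: "r \<le> 1" using p_pos by (simp add: zero_le_mult_iff)
        have "q * f (1 - r) \<le> q * f s" using r r1 s pq by (intro mult_left_mono fmono) auto
        \<comment> \<open>The weight \<open>q\<close> of \<open>f s\<close> is split as
          \<open>(q - p) + p\<close>: the first part needs only \<open>f s \<le> 1\<close>, the
          second uses subadditivity, and \<open>1 + (q - p) = 2 * q\<close>.\<close>
        moreover have "(q - p) * f s \<le> (q - p) * 1" using f_le_1[OF s] pq by (intro mult_left_mono) auto
        moreover have "p * f s \<le> p * (f a' + f b')"
          using fsub[of a' b'] a b s p_pos by (intro mult_left_mono) (auto simp: s_def)
        ultimately have "1 + q * f (1 - r) \<le> (q + p * f a') + (q + p * f b')"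
          using pq(5) by (simp add: algebra_simps)
        moreover have "1 - r \<le> 1" using r s by simp
        ultimately show ?thesis unfolding sum' using a b by (simp add: step_low step_high)
      qed
    qed
  qed
qed

text \<open>For \<open>u\<close> and \<open>v\<close> in the same branch,
  \<open>p * u + q * v\<close> lies there too with coordinate \<open>p * u' + q * v'\<close>, so the
  inequality for \<open>f\<close> rescales; \<open>q * q + p * q = q\<close> balances the constants
  of the high branch. The substance is the case of \<open>v\<close> low and \<open>u\<close>
  high.\<close>

private lemma step_two_point:
  assumes "0 \<le> v" "v \<le> u" "u \<le> 1"
  shows "iso_step p f (p * u + q * v) \<le> q * iso_step p f u + p * iso_step p f v"
proof -
  have u0: "0 \<le> u" and v1: "v \<le> 1" using assms by auto
  from u0 assms(3) show ?thesis
  proof (cases rule: cases_unit)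
    case (low u')
    note u = this
    from assms(1) v1 show ?thesis
    proof (cases rule: cases_unit)
      case (low v')
      note v = this
      have vu: "v' \<le> u'" using u v assms p_pos by simp
      have w: "p * u + q * v = p * (p * u' + q * v')" using u v by (simp add: algebra_simps)
      have "p * u' + q * v' \<le> 1" using u v pq p_pos
        by (intro convex_bound_le) auto
      moreover have "q * f (p * u' + q * v') \<le> q * (q * f u' + p * f v')"
        using ftwo[of v' u'] u v vu pq by (intro mult_left_mono) auto
      moreover have "\<dots> = q * (q * f u') + p * (q * f v')" by (simp add: algebra_simps)
      ultimately show ?thesis unfolding w using u v by (simp add: step_low)
    next
      case (high v')
      have "0 \<le> q * v'" using high pq by simp
      moreover have "p * u' < p" using u p_pos by simp
      ultimately show ?thesis using assms u high by simp
    qed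
  next
    case (high u')
    note u = this
    from assms(1) v1 show ?thesis
    proof (cases rule: cases_unit)
      case (low v')
      note v = this
      \<comment> \<open>Two-point inequality across the breakpoint \<open>p\<close>: unfolding the recursion twice at
        \<open>p u + q v\<close> reduces it to subadditivity if \<open>u' + v' \<le> 1\<close> and to its dual otherwise.\<close>
      define s where "s = u' + v'"
      have w: "p * u + q * v = p * (p + q * s)" using u v by (simp add: s_def algebra_simps)
      show ?thesis
      proof (cases "s \<le> 1")
        case True
        have s0: "0 \<le> s" using u v by (simp add: s_def)
        have "q * s \<le> q * 1" using True pq by (intro mult_left_mono) auto
        then have le1: "p + q * s \<le> 1" using pq(5) by simp
        \<comment> \<open>The second unfolding is an inequality only, supplied by the clause
          \<open>f x \<le> iso_step p f x\<close>. It replaces \<open>p + q * s\<close> by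
          \<open>s\<close>, where subadditivity applies.\<close>
        have "f (p + q * s) \<le> q + p * f s"
          using fstep[of "p + q * s"] le1 s0 p_pos pq by (simp add: step_high)
        also have "\<dots> \<le> q + p * (f u' + f v')"
          using fsub[of u' v'] u v True p_pos by (simp add: s_def)
        finally have "q * f (p + q * s) \<le> q * (q + p * (f u' + f v'))"
          using pq by (intro mult_left_mono) auto
        also have "\<dots> = q * (q + p * f u') + p * (q * f v')" by (simp add: algebra_simps)
        finally show ?thesis unfolding w using u v le1 by (simp add: step_low step_high)
      next
        case False
        define s' where "s' = s - 1"
        have s': "0 \<le> s'" "s' \<le> 1" using False u v by (auto simp: s_def s'_def)
        have ps: "0 \<le> p * s'" "p * s' \<le> 1" using s' p_pos pq by (auto intro: mult_le_one)
        have "p * (p + q * s) = p * (p + q) + q * (p * s')"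
          by (simp add: s'_def algebra_simps)
        then have w': "p * (p + q * s) = p + q * (p * s')" using pq(5) by simp
        have "f (p * s') \<le> q * f s'" using fstep[OF ps] s' by (simp add: step_low)
        also have "\<dots> \<le> q * (f u' + f v' - 1)"
          using fcosub[of u' v'] False u v pq by (intro mult_left_mono) (auto simp: s_def s'_def)
        finally have "p * f (p * s') \<le> p * (q * (f u' + f v' - 1))"
          using p_pos by (intro mult_left_mono) auto
        moreover have "q * q + p * q = q" using pq(5)
          by (metis distrib_right add.commute mult_1)
        ultimately have "q + p * f (p * s') \<le> q * (q + p * f u') + p * (q * f v')"
          by (simp add: algebra_simps)
        then show ?thesis unfolding w w' using u v ps by (simp add: step_low step_high)
      qed
    next
      case (high v')
      note v = this
      have vu: "v' \<le> u'" using u v assms pq by simp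
      have "p * u + q * v = (p + q) * p + q * (p * u' + q * v')"
        using u v by (simp add: algebra_simps)
      then have w: "p * u + q * v = p + q * (p * u' + q * v')" using pq(5) by simp
      have "p * f (p * u' + q * v') \<le> p * (q * f u' + p * f v')"
        using ftwo[of v' u'] u v vu p_pos by (intro mult_left_mono) auto
      moreover have "q * q + p * q = q" using pq(5)
        by (metis distrib_right add.commute mult_1)
      ultimately have "q + p * f (p * u' + q * v') \<le> q * (q + p * f u') + p * (q + p * f v')"
        by (simp add: algebra_simps)
      moreover have "0 \<le> p * u' + q * v'" using u v p_pos pq by simp
      ultimately show ?thesis unfolding w using u v by (simp add: step_high)
    qed
  qed
qed

lemma profile_iso_step: "profile p (iso_step p f)"
  unfolding profile_def
proof (intro conjI allI impI)
  show "iso_step p f 0 = 0" using step_low[of 0] f0 by simp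
  show "iso_step p f 1 = 1" using step_high[of 1] f1 pq by simp
  show "iso_step p f x \<le> iso_step p f y" if "0 \<le> x" "x \<le> y" "y \<le> 1" for x y
    using step_mono that .
  show "iso_step p f (a + b) \<le> iso_step p f a + iso_step p f b"
    if "0 \<le> a" "0 \<le> b" "a + b \<le> 1" for a b
    using step_subadd_ordered[of a b] step_subadd_ordered[of b a] that by (simp add: add.commute)
      (metis linear)
  show "1 + iso_step p f (a + b - 1) \<le> iso_step p f a + iso_step p f b"
    if "a \<le> 1" "b \<le> 1" "1 \<le> a + b" for a b
    using step_cosubadd_ordered[of a b] step_cosubadd_ordered[of b a] that by (simp add: add.commute)
      (metis linear)
  show "iso_step p f x \<le> iso_step p (iso_step p f) x" if "0 \<le> x" "x \<le> 1" for x
    using that p_pos pq fstep by (intro iso_step_mono) auto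
  show "iso_step p f (p * u + (1 - p) * v) \<le> (1 - p) * iso_step p f u + p * iso_step p f v"
    if "0 \<le> v" "v \<le> u" "u \<le> 1" for u v
    using step_two_point that unfolding q_def by simp
qed

end

text \<open>The starting point of the iteration. Subadditivity and its dual are equalities here; the
  last two clauses follow from \<open>1 - 2 * p \<ge> 0\<close>.\<close>

lemma profile_id:
  assumes "0 < p" "p \<le> 1 / 2"
  shows "profile p (\<lambda>x. x)"
proof -
  have "x \<le> iso_step p (\<lambda>x. x) x" if x: "0 \<le> x" "x \<le> 1" for x
  proof -
    have "p < 1" using assms by simp
    from assms(1) this x show ?thesis
    proof (cases rule: unit_interval_cases)
      case (low a)
      then have "p * a \<le> (1 - p) * a" using assms by (intro mult_right_mono) auto
      then show ?thesis using low assms by (simp add: iso_step_def)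
    next
      case (high a)
      have "(1 - 2 * p) * a \<le> (1 - 2 * p) * 1" using high assms by (intro mult_left_mono) auto
      then have "p + (1 - p) * a \<le> (1 - p) + p * a" by (simp add: algebra_simps)
      moreover have "\<not> (1 - p) * a < 0" using high assms by (simp add: not_less)
      ultimately show ?thesis using high assms by (simp add: iso_step_def)
    qed
  qed
  moreover have "p * u + (1 - p) * v \<le> (1 - p) * u + p * v" if "v \<le> u" for u v
  proof -
    have "(1 - 2 * p) * v \<le> (1 - 2 * p) * u" using that assms by (intro mult_left_mono) auto
    then show ?thesis by (simp add: algebra_simps)
  qed
  ultimately show ?thesis by (simp add: profile_def)
qed

lemma profile_funpow_iso_step:
  assumes "0 < p" "p \<le> 1 / 2"
  shows "profile p ((iso_step p ^^ k) (\<lambda>x. x))"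
  by (induction k) (simp_all add: profile_id[OF assms] profile_iso_step[OF assms refl])


section \<open>Slicing along the last coordinate\<close>

text \<open>Assembles a set in dimension \<open>Suc n\<close> from its slices. Points of
  \<open>Kverts t n\<close> are undefined at \<open>Suc n\<close>, so the update appends a
  coordinate.\<close>

definition Kjoin :: "nat \<Rightarrow> nat \<Rightarrow> (nat \<Rightarrow> (nat \<Rightarrow> nat) set) \<Rightarrow> (nat \<Rightarrow> nat) set" where
  "Kjoin t n F = (\<Union>j\<in>{1..t}. (\<lambda>y. y(Suc n := j)) ` F j)"

lemma finite_Kverts: "finite (Kverts t n)"
  unfolding Kverts_def by (intro finite_PiE) auto

lemma card_Kverts: "card (Kverts t n) = t ^ n"
  unfolding Kverts_def by (simp add: card_PiE)

lemma Kverts_upd: "y \<in> Kverts t n \<Longrightarrow> j \<in> {1..t} \<Longrightarrow> y(Suc n := j) \<in> Kverts t (Suc n)"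
  unfolding Kverts_def by (auto simp: PiE_iff extensional_def)

text \<open>Both points take the default value at \<open>Suc n\<close>, so resetting that coordinate
  recovers them from their updates.\<close>

lemma Kverts_upd_eq_iff:
  assumes "y \<in> Kverts t n" "z \<in> Kverts t n"
  shows "y(Suc n := i) = z(Suc n := j) \<longleftrightarrow> y = z \<and> i = j"
proof -
  have "y (Suc n) = z (Suc n)" using assms by (auto simp: Kverts_def PiE_iff extensional_def)
  then show ?thesis by (metis fun_upd_same fun_upd_triv fun_upd_upd)
qed

lemma Kverts_SucE:
  assumes "x \<in> Kverts t (Suc n)"
  obtains y j where "y \<in> Kverts t n" "j \<in> {1..t}" "x = y(Suc n := j)"
proof
  show "x(Suc n := undefined) \<in> Kverts t n"
    using assms by (auto simp: Kverts_def PiE_iff extensional_def)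
  show "x (Suc n) \<in> {1..t}" using assms by (auto simp: Kverts_def PiE_iff)
qed simp

lemma Kadj_upd_iff:
  assumes "y \<in> Kverts t n" "z \<in> Kverts t n" "i \<in> {1..t}" "j \<in> {1..t}"
  shows "Kadj t (Suc n) (y(Suc n := i)) (z(Suc n := j)) \<longleftrightarrow> Kadj t n y z \<and> i \<noteq> j"
  using assms Kverts_upd[OF assms(1,3)] Kverts_upd[OF assms(2,4)]
  by (auto simp: Kadj_def atLeastAtMostSuc_conv)

lemma Kboundary_subset: "Kboundary t n S \<subseteq> Kverts t n"
  by (auto simp: Kboundary_def)

lemma Kjoin_subset: "(\<And>j. F j \<subseteq> Kverts t n) \<Longrightarrow> Kjoin t n F \<subseteq> Kverts t (Suc n)"
  unfolding Kjoin_def using Kverts_upd by blast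

lemma Kjoin_cover:
  assumes "S \<subseteq> Kverts t (Suc n)"
  obtains F where "\<And>j. F j \<subseteq> Kverts t n" "S = Kjoin t n F"
proof
  show "S = Kjoin t n (\<lambda>j. {y \<in> Kverts t n. y(Suc n := j) \<in> S})"
  proof (intro subset_antisym subsetI)
    fix x assume x: "x \<in> S"
    then obtain y j where "y \<in> Kverts t n" "j \<in> {1..t}" "x = y(Suc n := j)"
      using assms Kverts_SucE by blast
    with x show "x \<in> Kjoin t n (\<lambda>j. {y \<in> Kverts t n. y(Suc n := j) \<in> S})"
      unfolding Kjoin_def by blast
  qed (auto simp: Kjoin_def)
qed auto

lemma card_Kjoin:
  assumes F: "\<And>j. F j \<subseteq> Kverts t n"
  shows "card (Kjoin t n F) = (\<Sum>j=1..t. card (F j))"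
proof -
  have fin: "finite (F j)" for j by (rule finite_subset[OF F finite_Kverts])
  have upd_eq: "y(Suc n := i) = z(Suc n := j) \<longleftrightarrow> y = z \<and> i = j" if "y \<in> F i" "z \<in> F j" for y z i j
    using Kverts_upd_eq_iff[of y t n z] F that by blast
  have "card (Kjoin t n F) = (\<Sum>j=1..t. card ((\<lambda>y. y(Suc n := j)) ` F j))"
    unfolding Kjoin_def
  proof (rule card_UN_disjoint)
    show "\<forall>i\<in>{1..t}. \<forall>j\<in>{1..t}. i \<noteq> j \<longrightarrow>
        (\<lambda>y. y(Suc n := i)) ` F i \<inter> (\<lambda>y. y(Suc n := j)) ` F j = {}"
      using upd_eq by (auto simp: disjoint_iff)
  qed (auto simp: fin)
  also have "\<dots> = (\<Sum>j=1..t. card (F j))"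
  proof (intro sum.cong refl card_image inj_onI)
    fix j y z assume "y \<in> F j" "z \<in> F j" "y(Suc n := j) = z(Suc n := j)"
    then show "y = z" using upd_eq by blast
  qed
  finally show ?thesis .
qed

text \<open>Adjacent points differ in the last coordinate as well, so slice \<open>i\<close> of the
  boundary sees every slice except \<open>F i\<close>.\<close>

lemma Kboundary_Kjoin:
  assumes F: "\<And>j. F j \<subseteq> Kverts t n"
  shows "Kboundary t (Suc n) (Kjoin t n F) =
    Kjoin t n (\<lambda>i. \<Union>j\<in>{1..t} - {i}. Kboundary t n (F j))"
proof (intro subset_antisym subsetI)
  fix x assume "x \<in> Kboundary t (Suc n) (Kjoin t n F)"
  then obtain z j where x: "x \<in> Kverts t (Suc n)" and zj: "j \<in> {1..t}" "z \<in> F j"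
    and adj: "Kadj t (Suc n) x (z(Suc n := j))"
    by (auto simp: Kboundary_def Kjoin_def)
  from x obtain y i where yi: "y \<in> Kverts t n" "i \<in> {1..t}" "x = y(Suc n := i)"
    by (rule Kverts_SucE)
  have "Kadj t n y z \<and> i \<noteq> j" using adj Kadj_upd_iff[of y t n z i j] yi zj F by blast
  then have "y \<in> (\<Union>j\<in>{1..t} - {i}. Kboundary t n (F j))"
    using yi zj by (auto simp: Kboundary_def)
  then show "x \<in> Kjoin t n (\<lambda>i. \<Union>j\<in>{1..t} - {i}. Kboundary t n (F j))"
    using yi unfolding Kjoin_def by blast
next
  fix x assume "x \<in> Kjoin t n (\<lambda>i. \<Union>j\<in>{1..t} - {i}. Kboundary t n (F j))"
  then obtain i y j z where x: "x = y(Suc n := i)" and i: "i \<in> {1..t}" and j: "j \<in> {1..t}" "i \<noteq> j"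
    and y: "y \<in> Kverts t n" and z: "z \<in> F j" and adj: "Kadj t n y z"
    unfolding Kboundary_def Kjoin_def by blast
  have "Kadj t (Suc n) x (z(Suc n := j))"
    using adj Kadj_upd_iff[of y t n z i j] x y z i j F by blast
  moreover have "z(Suc n := j) \<in> Kjoin t n F" using z j by (auto simp: Kjoin_def)
  ultimately show "x \<in> Kboundary t (Suc n) (Kjoin t n F)"
    using Kverts_upd[OF y i] x by (auto simp: Kboundary_def)
qed

section \<open>Double counting along fibres\<close>

lemma sum_card_eq_sum_count:
  assumes "finite I" "finite K" "\<And>i. i \<in> I \<Longrightarrow> A i \<subseteq> K"
  shows "(\<Sum>i\<in>I. card (A i)) = (\<Sum>x\<in>K. card {i \<in> I. x \<in> A i})"
proof -
  have "(\<Sum>i\<in>I. card (A i)) = (\<Sum>i\<in>I. card {x \<in> K. x \<in> A i})"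
    using assms by (intro sum.cong arg_cong[of _ _ card]) auto
  also have "\<dots> = (\<Sum>x\<in>K. card {i \<in> I. x \<in> A i})"
    using sum_multicount_gen[of I K "\<lambda>i x. x \<in> A i" "\<lambda>x. card {i \<in> I. x \<in> A i}"] assms by simp
  finally show ?thesis .
qed

lemma sum_of_bool_mem: "finite K \<Longrightarrow> A \<subseteq> K \<Longrightarrow> (\<Sum>x\<in>K. of_bool (x \<in> A)) = card A"
  by (simp add: sum_of_bool_eq Int_absorb1 Collect_mem_eq)

context
  fixes t n :: nat and F :: "nat \<Rightarrow> (nat \<Rightarrow> nat) set" and U V :: "(nat \<Rightarrow> nat) set"
  assumes F: "\<And>j. F j \<subseteq> Kverts t n"
    and U_def: "U = (\<Union>j\<in>{1..t}. F j)"
    and V_def: "V = {y. \<exists>i\<in>{1..t}. \<exists>j\<in>{1..t}. i \<noteq> j \<and> y \<in> F i \<and> y \<in> F j}"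
begin

text \<open>A fibre over a point of \<open>U\<close> outside \<open>V\<close> has one element, and a
  fibre over a point of \<open>V\<close> has at most \<open>t = 1 + (t - 1)\<close>.\<close>

lemma card_Kjoin_le: "card (Kjoin t n F) \<le> card U + (t - 1) * card V"
proof -
  have sub: "U \<subseteq> Kverts t n" "V \<subseteq> Kverts t n" using F by (auto simp: U_def V_def)
  have count: "card {j \<in> {1..t}. x \<in> F j} \<le> of_bool (x \<in> U) + (t - 1) * of_bool (x \<in> V)" for x
  proof (cases "x \<in> V")
    case True
    then have "x \<in> U" "1 \<le> t" by (auto simp: U_def V_def)
    moreover have "card {j \<in> {1..t}. x \<in> F j} \<le> card {1..t}" by (intro card_mono) auto
    ultimately show ?thesis using True by simp
  next
    case False
    show ?thesis
    proof (cases "x \<in> U")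
      case True
      then obtain i where "i \<in> {1..t}" "x \<in> F i" by (auto simp: U_def)
      then have "{j \<in> {1..t}. x \<in> F j} = {i}" using False unfolding V_def by blast
      then show ?thesis using True by simp
    next
      case False
      then have "{j \<in> {1..t}. x \<in> F j} = {}" by (auto simp: U_def)
      then show ?thesis by (simp only: card.empty)
    qed
  qed
  have "card (Kjoin t n F) = (\<Sum>x\<in>Kverts t n. card {j \<in> {1..t}. x \<in> F j})"
    unfolding card_Kjoin[OF F] by (rule sum_card_eq_sum_count) (auto simp: finite_Kverts F)
  also have "\<dots> \<le> (\<Sum>x\<in>Kverts t n. of_bool (x \<in> U) + (t - 1) * of_bool (x \<in> V))"
    by (intro sum_mono count)
  also have "\<dots> = card U + (t - 1) * card V"
    unfolding sum.distrib sum_distrib_left[symmetric]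
    using sub by (simp add: sum_of_bool_mem finite_Kverts del: sum_of_bool_eq sum_mult_of_bool_eq)
  finally show ?thesis .
qed

text \<open>A neighbour of a point in slice \<open>j\<close> enters the boundary with every last
  coordinate other than \<open>j\<close>, hence \<open>t - 1\<close> times. If that point lies in
  two slices, each last coordinate differs from one of the two indices, so all \<open>t\<close>
  values occur.\<close>

lemma card_Kboundary_Kjoin_ge:
  assumes t: "1 \<le> t"
  shows "(t - 1) * card (Kboundary t n U) + card (Kboundary t n V)
    \<le> card (Kboundary t (Suc n) (Kjoin t n F))"
proof -
  define A where "A i = (\<Union>j\<in>{1..t} - {i}. Kboundary t n (F j))" for i
  have A: "A i \<subseteq> Kverts t n" for i using Kboundary_subset by (fastforce simp: A_def)
  have count: "(t - 1) * of_bool (x \<in> Kboundary t n U) + of_bool (x \<in> Kboundary t n V)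
      \<le> card {i \<in> {1..t}. x \<in> A i}" for x
  proof (cases "x \<in> Kboundary t n V")
    case True
    then obtain i j where ij: "i \<in> {1..t}" "j \<in> {1..t}" "i \<noteq> j"
      "x \<in> Kboundary t n (F i)" "x \<in> Kboundary t n (F j)"
      unfolding Kboundary_def V_def by blast
    then have "{k \<in> {1..t}. x \<in> A k} = {1..t}" unfolding A_def by blast
    then show ?thesis using t by simp
  next
    case False
    show ?thesis
    proof (cases "x \<in> Kboundary t n U")
      case True
      then obtain j where "j \<in> {1..t}" "x \<in> Kboundary t n (F j)"
        unfolding Kboundary_def U_def by blast
      then have "{1..t} - {j} \<subseteq> {k \<in> {1..t}. x \<in> A k}" "card ({1..t} - {j}) = t - 1"
        by (auto simp: A_def)
      then have "t - 1 \<le> card {k \<in> {1..t}. x \<in> A k}"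
        using card_mono[of "{k \<in> {1..t}. x \<in> A k}" "{1..t} - {j}"] by simp
      then show ?thesis using True False by simp
    qed (use False in simp)
  qed
  have "(t - 1) * card (Kboundary t n U) + card (Kboundary t n V) =
      (\<Sum>x\<in>Kverts t n. (t - 1) * of_bool (x \<in> Kboundary t n U) + of_bool (x \<in> Kboundary t n V))"
    unfolding sum.distrib sum_distrib_left[symmetric]
    by (simp add: sum_of_bool_mem finite_Kverts Kboundary_subset del: sum_of_bool_eq sum_mult_of_bool_eq)
  also have "\<dots> \<le> (\<Sum>x\<in>Kverts t n. card {i \<in> {1..t}. x \<in> A i})"
    by (intro sum_mono count)
  also have "\<dots> = (\<Sum>i=1..t. card (A i))"
    by (rule sum_card_eq_sum_count[symmetric]) (auto simp: finite_Kverts A[THEN subsetD])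
  also have "\<dots> = card (Kboundary t (Suc n) (Kjoin t n F))"
    unfolding Kboundary_Kjoin[OF F] A_def[symmetric] by (rule card_Kjoin[OF A, symmetric])
  finally show ?thesis .
qed

end

lemma Kmu_nonneg: "0 \<le> Kmu t n S"
  by (simp add: Kmu_def)

lemma Kmu_mono: "S \<subseteq> T \<Longrightarrow> T \<subseteq> Kverts t n \<Longrightarrow> Kmu t n S \<le> Kmu t n T"
  unfolding Kmu_def using finite_subset[OF _ finite_Kverts]
  by (intro divide_right_mono) (auto intro: card_mono)

lemma Kmu_Kverts: "1 \<le> t \<Longrightarrow> Kmu t n (Kverts t n) = 1"
  by (simp add: Kmu_def card_Kverts)

lemma Kmu_le_1: "1 \<le> t \<Longrightarrow> S \<subseteq> Kverts t n \<Longrightarrow> Kmu t n S \<le> 1"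
  using Kmu_mono[of S "Kverts t n" t n] Kmu_Kverts[of t n] by simp

section \<open>The isoperimetric inequality\<close>

text \<open>Passing from the \<open>t\<close> slices to the nested pair
  \<open>V \<subseteq> U\<close> leaves two sets for the induction hypothesis, so an inequality in
  two variables suffices.\<close>

lemma Kmu_Kboundary_ge:
  assumes t: "2 \<le> t" and prof: "profile (1 / real t) f" and S: "S \<subseteq> Kverts t n"
  shows "f (Kmu t n S) \<le> Kmu t n (Kboundary t n S)"
  using S
proof (induction n arbitrary: S)
  case 0
  have K0: "Kverts t 0 = {\<lambda>_. undefined}" by (simp add: Kverts_def)
  then consider "S = {}" | "S = Kverts t 0" using 0 by auto
  then show ?case
  proof cases
    case 1
    then show ?thesis using profile_0[OF prof] by (simp add: Kmu_def)
  next
    case 2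
    \<comment> \<open>In dimension 0 adjacency is vacuous, so the single vertex is its own
      neighbour.\<close>
    then have "Kboundary t 0 S = Kverts t 0"
      by (auto simp: Kboundary_def Kadj_def)
    then show ?thesis using 2 profile_1[OF prof] t Kmu_Kverts[of t 0] by simp
  qed
next
  case (Suc n)
  obtain F where F: "\<And>j. F j \<subseteq> Kverts t n" and S: "S = Kjoin t n F"
    using Kjoin_cover[OF Suc.prems] by metis
  define U where "U = (\<Union>j\<in>{1..t}. F j)"
  define V where "V = {y. \<exists>i\<in>{1..t}. \<exists>j\<in>{1..t}. i \<noteq> j \<and> y \<in> F i \<and> y \<in> F j}"
  have U: "U \<subseteq> Kverts t n" and V: "V \<subseteq> Kverts t n" and VU: "V \<subseteq> U"
    using F by (auto simp: U_def V_def)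
  define p where "p = 1 / real t"
  have p: "0 < p" "p \<le> 1 / 2" using t by (auto simp: p_def field_simps)
  have q: "1 - p = real (t - 1) / real t" using t by (simp add: p_def field_simps of_nat_diff)
  define u v where "u = Kmu t n U" and "v = Kmu t n V"
  have uv: "0 \<le> v" "v \<le> u" "u \<le> 1"
    using Kmu_nonneg Kmu_mono[OF VU U] Kmu_le_1[OF _ U] t by (auto simp: u_def v_def)
  have "real (card S) \<le> real (card U) + real (t - 1) * real (card V)"
    using of_nat_mono[OF card_Kjoin_le[OF F U_def V_def], where 'a = real]
    unfolding S of_nat_add of_nat_mult .
  then have "Kmu t (Suc n) S \<le> (card U + real (t - 1) * card V) / real t ^ Suc n"
    unfolding Kmu_def by (intro divide_right_mono) auto
  also have "\<dots> = p * u + (1 - p) * v"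
    unfolding q using t by (simp add: p_def u_def v_def Kmu_def field_simps)
  finally have le: "Kmu t (Suc n) S \<le> p * u + (1 - p) * v" .
  have "p * u + (1 - p) * v \<le> 1" using p uv by (intro convex_bound_le) auto
  then have "f (Kmu t (Suc n) S) \<le> f (p * u + (1 - p) * v)"
    using le Kmu_nonneg by (intro profile_mono[OF prof]) auto
  also have "\<dots> \<le> (1 - p) * f u + p * f v"
    using profile_two_point[OF prof] uv by (simp add: p_def)
  also have "\<dots> \<le> (1 - p) * Kmu t n (Kboundary t n U) + p * Kmu t n (Kboundary t n V)"
    using Suc.IH[OF U] Suc.IH[OF V] p by (intro add_mono mult_left_mono) (auto simp: u_def v_def)
  also have "\<dots> = (real (t - 1) * card (Kboundary t n U) + card (Kboundary t n V)) / real t ^ Suc n"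
    unfolding q using t by (simp add: p_def Kmu_def field_simps)
  also have "\<dots> \<le> Kmu t (Suc n) (Kboundary t (Suc n) S)"
  proof -
    have "real (t - 1) * card (Kboundary t n U) + card (Kboundary t n V)
        \<le> card (Kboundary t (Suc n) S)"
      using of_nat_mono[OF card_Kboundary_Kjoin_ge[OF F U_def V_def], where 'a = real] t
      unfolding S of_nat_add of_nat_mult by simp
    then show ?thesis unfolding Kmu_def by (intro divide_right_mono) auto
  qed
  finally show ?case .
qed

section \<open>The infimum \<open>Phi\<close> and its lower bound by profiles\<close>

lemma Phi_graph_lower:
  assumes "S \<subseteq> Kverts t n" "\<nu> \<le> Kmu t n S"
  shows "Phi_graph t n \<nu> \<le> Kmu t n (Kboundary t n S)"
  unfolding Phi_graph_def using assms Kmu_nonneg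
  by (intro cInf_lower bdd_belowI[of _ 0]) auto

lemma Phi_graph_greatest:
  assumes "1 \<le> t" "\<nu> \<le> 1"
    and "\<And>S. S \<subseteq> Kverts t n \<Longrightarrow> \<nu> \<le> Kmu t n S \<Longrightarrow> c \<le> Kmu t n (Kboundary t n S)"
  shows "c \<le> Phi_graph t n \<nu>"
  unfolding Phi_graph_def
proof (rule cInf_greatest)
  show "{Kmu t n (Kboundary t n S) |S. S \<subseteq> Kverts t n \<and> Kmu t n S \<ge> \<nu>} \<noteq> {}"
    using assms(1,2) Kmu_Kverts[of t n] by auto
qed (use assms(3) in auto)

lemma Phi_lower:
  assumes "1 \<le> t" "\<nu> \<le> 1" "1 \<le> n" "S \<subseteq> Kverts t n" "\<nu> \<le> Kmu t n S"
  shows "Phi t \<nu> \<le> Kmu t n (Kboundary t n S)"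
proof -
  have "0 \<le> Phi_graph t m \<nu>" for m
    using Phi_graph_greatest[OF assms(1,2)] Kmu_nonneg by blast
  then have "Phi t \<nu> \<le> Phi_graph t n \<nu>"
    unfolding Phi_def using assms(3) by (intro cINF_lower bdd_belowI[of _ 0]) auto
  also have "\<dots> \<le> Kmu t n (Kboundary t n S)" using assms by (intro Phi_graph_lower)
  finally show ?thesis .
qed

lemma Phi_greatest:
  assumes "1 \<le> t" "\<nu> \<le> 1"
    and "\<And>n S. 1 \<le> n \<Longrightarrow> S \<subseteq> Kverts t n \<Longrightarrow> \<nu> \<le> Kmu t n S \<Longrightarrow> c \<le> Kmu t n (Kboundary t n S)"
  shows "c \<le> Phi t \<nu>"
  unfolding Phi_def using assms by (intro cINF_greatest Phi_graph_greatest) auto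

lemma Phi_le_1: "1 \<le> t \<Longrightarrow> \<nu> \<le> 1 \<Longrightarrow> Phi t \<nu> \<le> 1"
  using Phi_lower[of t \<nu> 1 "Kverts t 1"] Kmu_Kverts[of t 1]
    Kmu_le_1[OF _ Kboundary_subset, of t 1 "Kverts t 1"] by simp

lemma profile_le_Phi:
  assumes t: "2 \<le> t" and prof: "profile (1 / real t) f" and \<nu>: "0 \<le> \<nu>" "\<nu> \<le> 1"
  shows "f \<nu> \<le> Phi t \<nu>"
proof (rule Phi_greatest)
  fix n S assume S: "S \<subseteq> Kverts t n" "\<nu> \<le> Kmu t n S"
  then have "f \<nu> \<le> f (Kmu t n S)" using Kmu_le_1[of t S n] t \<nu> by (intro profile_mono[OF prof]) auto
  then show "f \<nu> \<le> Kmu t n (Kboundary t n S)" using Kmu_Kboundary_ge[OF t prof S(1)] by simp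
qed (use t \<nu> in auto)

section \<open>Upper bounds from sets built in the next dimension\<close>

lemma sum_if_1:
  fixes a b :: real
  assumes "1 \<le> t"
  shows "(\<Sum>j=1..t. if j = 1 then a else b) = a + (real t - 1) * b"
proof -
  have "(\<Sum>j=1..t. if j = 1 then a else b) = a + (\<Sum>j=Suc 1..t. if j = 1 then a else b)"
    using assms by (subst sum.atLeast_Suc_atMost) auto
  also have "(\<Sum>j=Suc 1..t. if j = 1 then a else b) = (\<Sum>j=Suc 1..t. b)"
    by (intro sum.cong) auto
  finally show ?thesis using assms by (simp add: of_nat_diff)
qed

text \<open>With \<open>S\<close> in slice 1 and all other slices empty, the density is divided by
  \<open>t\<close>, and the boundary lies in copies of the boundary of \<open>S\<close> in the
  \<open>t - 1\<close> other slices.\<close>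

lemma Phi_le_low:
  assumes t: "2 \<le> t" and \<nu>: "0 \<le> \<nu>" "\<nu> < 1 / real t"
  shows "Phi t \<nu> \<le> (real t - 1) / real t * Phi t (real t * \<nu>)"
proof -
  \<comment> \<open>Moving the factor to the left isolates the infimum on the right, so that one
    competitor \<open>S\<close> at a time can be treated.\<close>
  have "Phi t \<nu> / ((real t - 1) / real t) \<le> Phi t (real t * \<nu>)"
  proof (rule Phi_greatest)
    show "real t * \<nu> \<le> 1" using \<nu> t by (simp add: field_simps)
    fix n S assume S: "S \<subseteq> Kverts t n" and mS: "real t * \<nu> \<le> Kmu t n S"
    define F where "F j = (if j = (1::nat) then S else {})" for j
    have F: "F j \<subseteq> Kverts t n" for j using S by (simp add: F_def)
    define A where "A i = (\<Union>j\<in>{1..t} - {i}. Kboundary t n (F j))" for i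
    have A: "A i \<subseteq> Kverts t n" for i using Kboundary_subset by (fastforce simp: A_def)
    have "real (card (Kjoin t n F)) = (\<Sum>j=1..t. if j = 1 then real (card S) else 0)"
      unfolding card_Kjoin[OF F] of_nat_sum by (intro sum.cong) (auto simp: F_def)
    also have "\<dots> = card S" using sum_if_1[of t "real (card S)" 0] t by simp
    finally have "Kmu t (Suc n) (Kjoin t n F) = Kmu t n S / real t" by (simp add: Kmu_def)
    then have m: "\<nu> \<le> Kmu t (Suc n) (Kjoin t n F)"
      using mS t by (simp add: pos_le_divide_eq mult.commute)
    have "real (card (Kboundary t (Suc n) (Kjoin t n F))) = (\<Sum>i=1..t. real (card (A i)))"
      unfolding Kboundary_Kjoin[OF F] A_def[symmetric] card_Kjoin[OF A] by simp
    also have "\<dots> \<le> (\<Sum>i=1..t. if i = 1 then 0 else real (card (Kboundary t n S)))"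
    proof (intro sum_mono)
      fix i
      have "A i \<subseteq> (if i = 1 then {} else Kboundary t n S)"
        by (auto simp: A_def F_def Kboundary_def split: if_splits)
      moreover have "finite (Kboundary t n S)"
        by (rule finite_subset[OF Kboundary_subset finite_Kverts])
      ultimately show "real (card (A i)) \<le> (if i = 1 then 0 else real (card (Kboundary t n S)))"
        by (auto intro: card_mono)
    qed
    also have "\<dots> = (real t - 1) * card (Kboundary t n S)" using sum_if_1[of t 0] t by simp
    finally have "Kmu t (Suc n) (Kboundary t (Suc n) (Kjoin t n F))
        \<le> (real t - 1) * card (Kboundary t n S) / real t ^ Suc n"
      unfolding Kmu_def by (intro divide_right_mono) auto
    also have "\<dots> = (real t - 1) / real t * Kmu t n (Kboundary t n S)" by (simp add: Kmu_def)
    finally have "Kmu t (Suc n) (Kboundary t (Suc n) (Kjoin t n F))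
        \<le> (real t - 1) / real t * Kmu t n (Kboundary t n S)" .
    moreover have "1 / real t \<le> 1" using t by simp
    then have "\<nu> \<le> 1" using \<nu> by linarith
    then have "Phi t \<nu> \<le> Kmu t (Suc n) (Kboundary t (Suc n) (Kjoin t n F))"
      using Phi_lower[OF _ _ _ Kjoin_subset[OF F] m] t by simp
    ultimately have "Phi t \<nu> \<le> (real t - 1) / real t * Kmu t n (Kboundary t n S)" by linarith
    moreover have "0 < (real t - 1) / real t" using t by simp
    ultimately show "Phi t \<nu> / ((real t - 1) / real t) \<le> Kmu t n (Kboundary t n S)"
      by (simp only: pos_divide_le_eq mult.commute)
  qed (use t in auto)
  moreover have "0 < (real t - 1) / real t" using t by simp
  ultimately show ?thesis by (simp only: pos_divide_le_eq mult.commute)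
qed

text \<open>With slice 1 full and \<open>S\<close> in the others, the density becomes
  \<open>(1 + (t - 1) * Kmu t n S) / t\<close>; solving for \<open>Kmu t n S\<close> gives the
  argument on the right.\<close>

lemma Phi_le_high:
  assumes t: "2 \<le> t" and \<nu>: "1 / real t \<le> \<nu>" "\<nu> \<le> 1"
  shows "Phi t \<nu> \<le> (real t - 1) / real t + 1 / real t * Phi t ((real t * \<nu> - 1) / (real t - 1))"
proof -
  have "real t * Phi t \<nu> - (real t - 1) \<le> Phi t ((real t * \<nu> - 1) / (real t - 1))"
  proof (rule Phi_greatest)
    show "(real t * \<nu> - 1) / (real t - 1) \<le> 1" using \<nu> t by (simp add: field_simps)
    fix n S assume S: "S \<subseteq> Kverts t n" and mS: "(real t * \<nu> - 1) / (real t - 1) \<le> Kmu t n S"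
    define F where "F j = (if j = (1::nat) then Kverts t n else S)" for j
    have F: "F j \<subseteq> Kverts t n" for j using S by (simp add: F_def)
    define A where "A i = (\<Union>j\<in>{1..t} - {i}. Kboundary t n (F j))" for i
    have A: "A i \<subseteq> Kverts t n" for i using Kboundary_subset by (fastforce simp: A_def)
    have "real (card (Kjoin t n F)) = (\<Sum>j=1..t. if j = 1 then real t ^ n else real (card S))"
      unfolding card_Kjoin[OF F] of_nat_sum by (intro sum.cong) (auto simp: F_def card_Kverts)
    also have "\<dots> = real t ^ n + (real t - 1) * card S" using sum_if_1 t by simp
    finally have "Kmu t (Suc n) (Kjoin t n F) = (1 + (real t - 1) * Kmu t n S) / real t"
      using t by (simp add: Kmu_def field_simps)
    moreover have "real t * \<nu> - 1 \<le> (real t - 1) * Kmu t n S"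
      using mS t by (simp add: pos_divide_le_eq mult.commute)
    ultimately have m: "\<nu> \<le> Kmu t (Suc n) (Kjoin t n F)"
      using t by (simp add: pos_le_divide_eq mult.commute)
    have "real (card (Kboundary t (Suc n) (Kjoin t n F))) = (\<Sum>i=1..t. real (card (A i)))"
      unfolding Kboundary_Kjoin[OF F] A_def[symmetric] card_Kjoin[OF A] by simp
    also have "\<dots> \<le> (\<Sum>i=1..t. if i = 1 then real (card (Kboundary t n S)) else real t ^ n)"
    proof (intro sum_mono)
      fix i
      \<comment> \<open>Slice 1 sees only copies of \<open>S\<close>. The other slices see the full
        one, and bounding them by everything is enough for an upper estimate.\<close>
      have "A i \<subseteq> (if i = 1 then Kboundary t n S else Kverts t n)"
      proof (cases "i = 1")
        case True
        then show ?thesis by (auto simp: A_def F_def)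
      qed (use A in simp)
      moreover have "finite (Kboundary t n S)"
        by (rule finite_subset[OF Kboundary_subset finite_Kverts])
      ultimately have "card (A i) \<le> (if i = 1 then card (Kboundary t n S) else card (Kverts t n))"
        using finite_Kverts[of t n] by (auto intro: card_mono)
      then show "real (card (A i)) \<le> (if i = 1 then real (card (Kboundary t n S)) else real t ^ n)"
        unfolding card_Kverts by (simp split: if_splits flip: of_nat_power)
    qed
    also have "\<dots> = card (Kboundary t n S) + (real t - 1) * real t ^ n" using sum_if_1 t by simp
    finally have "Kmu t (Suc n) (Kboundary t (Suc n) (Kjoin t n F))
        \<le> (card (Kboundary t n S) + (real t - 1) * real t ^ n) / real t ^ Suc n"
      unfolding Kmu_def by (intro divide_right_mono) auto
    also have "\<dots> = (Kmu t n (Kboundary t n S) + (real t - 1)) / real t"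
      using t by (simp add: Kmu_def field_simps)
    finally have "Phi t \<nu> \<le> (Kmu t n (Kboundary t n S) + (real t - 1)) / real t"
      using Phi_lower[OF _ _ _ Kjoin_subset[OF F] m] t \<nu> by simp
    then show "real t * Phi t \<nu> - (real t - 1) \<le> Kmu t n (Kboundary t n S)"
      using t by (simp add: field_simps)
  qed (use t in auto)
  then have "Phi t \<nu> \<le> (real t - 1 + Phi t ((real t * \<nu> - 1) / (real t - 1))) / real t"
    using t by (simp add: pos_le_divide_eq mult.commute)
  then show ?thesis by (simp add: add_divide_distrib)
qed

section \<open>The fixed point equation\<close>

lemma iso_step_inverse_nat:
  assumes "2 \<le> t"
  shows "iso_step (1 / real t) f x = (if x < 1 / real t then (real t - 1) / real t * f (real t * x)
    else (real t - 1) / real t + 1 / real t * f ((real t * x - 1) / (real t - 1)))"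
proof -
  have "(x - 1 / real t) / (1 - 1 / real t) = (real t * x - 1) / (real t - 1)"
    and "1 - 1 / real t = (real t - 1) / real t"
    using assms by (simp_all add: field_simps)
  then show ?thesis unfolding iso_step_def by (simp only: divide_divide_eq_right div_by_1 mult.commute)
qed

lemma Phi_le_iso_step:
  assumes "2 \<le> t" "0 \<le> \<nu>" "\<nu> \<le> 1"
  shows "Phi t \<nu> \<le> iso_step (1 / real t) (Phi t) \<nu>"
  unfolding iso_step_inverse_nat[OF assms(1)] using Phi_le_low[of t \<nu>] Phi_le_high[of t \<nu>] assms by simp

text \<open>Monotonicity of the operator carries the bound one iterate further, and the contraction
  multiplies the error by \<open>1 - p\<close>.\<close>

lemma iso_step_le_funpow_add:
  assumes p: "0 < p" "p \<le> 1 / 2" and x: "0 \<le> x" "x \<le> 1"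
    and le: "\<And>y. 0 \<le> y \<Longrightarrow> y \<le> 1 \<Longrightarrow> h y \<le> (iso_step p ^^ k) f y + (1 - p) ^ k"
  shows "iso_step p h x \<le> (iso_step p ^^ Suc k) f x + (1 - p) ^ Suc k"
proof -
  have "iso_step p h x \<le> iso_step p (\<lambda>y. (iso_step p ^^ k) f y + (1 - p) ^ k) x"
    using p x le by (intro iso_step_mono) auto
  also have "\<dots> \<le> iso_step p ((iso_step p ^^ k) f) x + (1 - p) * (1 - p) ^ k"
    using p by (intro iso_step_add_const) auto
  finally show ?thesis by simp
qed

lemma Phi_eq_iso_step:
  assumes t: "2 \<le> t" and \<nu>: "0 \<le> \<nu>" "\<nu> \<le> 1"
  shows "Phi t \<nu> = iso_step (1 / real t) (Phi t) \<nu>"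
proof (rule antisym)
  show "Phi t \<nu> \<le> iso_step (1 / real t) (Phi t) \<nu>" using Phi_le_iso_step assms .
  define p where "p = 1 / real t"
  have p: "0 < p" "p \<le> 1 / 2" using t by (auto simp: p_def field_simps)
  define G where "G k = (iso_step p ^^ k) (\<lambda>x. x)" for k
  \<comment> \<open>The initial error 1 comes from \<open>Phi t y \<le> 1\<close>; each further
    iterate uses \<open>Phi t y \<le> iso_step p (Phi t) y\<close> once.\<close>
  have Phi_le: "Phi t y \<le> G k y + (1 - p) ^ k" if "0 \<le> y" "y \<le> 1" for k y
    using that
  proof (induction k arbitrary: y)
    case 0
    then show ?case using Phi_le_1[of t y] t by (simp add: G_def)
  next
    case (Suc k)
    have "Phi t y \<le> iso_step p (Phi t) y" unfolding p_def using Phi_le_iso_step t Suc.prems .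
    also have "\<dots> \<le> G (Suc k) y + (1 - p) ^ Suc k"
      unfolding G_def using p Suc by (intro iso_step_le_funpow_add) (auto simp: G_def)
    finally show ?case .
  qed
  \<comment> \<open>The same iterate \<open>G (Suc k)\<close> is a profile, hence below
    \<open>Phi t\<close>, and lies within \<open>(1 - p) ^ Suc k\<close> of bounding
    \<open>iso_step p (Phi t)\<close> from above.\<close>
  have bound: "iso_step p (Phi t) \<nu> - Phi t \<nu> \<le> (1 - p) ^ Suc k" for k
  proof -
    have "iso_step p (Phi t) \<nu> \<le> G (Suc k) \<nu> + (1 - p) ^ Suc k"
      unfolding G_def using p \<nu> Phi_le by (intro iso_step_le_funpow_add) (auto simp: G_def)
    moreover have "G (Suc k) \<nu> \<le> Phi t \<nu>"
      unfolding G_def p_def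
      using profile_le_Phi[OF t profile_funpow_iso_step \<nu>] p unfolding p_def by blast
    ultimately show ?thesis by simp
  qed
  have "(\<lambda>k. (1 - p) ^ Suc k) \<longlonglongrightarrow> 0" using p by (intro LIMSEQ_Suc LIMSEQ_realpow_zero) auto
  then have "iso_step p (Phi t) \<nu> - Phi t \<nu> \<le> 0"
    by (rule LIMSEQ_le_const) (use bound in blast)
  then show "iso_step (1 / real t) (Phi t) \<nu> \<le> Phi t \<nu>" by (simp add: p_def)
qed

theorem theorem2p8:
  fixes t :: nat and \<nu> :: real
  assumes "t \<ge> 3" and "0 \<le> \<nu>" and "\<nu> \<le> 1"
  shows "Phi t \<nu> =
    (if \<nu> < 1 / real t
     then (real t - 1) / real t * Phi t (real t * \<nu>)
     else (real t - 1) / real t + 1 / real t * Phi t ((real t * \<nu> - 1) / (real t - 1)))"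
  using Phi_eq_iso_step[of t \<nu>] iso_step_inverse_nat[of t "Phi t" \<nu>] assms by simp

end
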